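(* Let $q$ be a prime and let $V_{q-1}=\{\mathbf{0},\mathbf{e}_1,\dots,\mathbf{e}_{q-1}\}\subset\mathbb{Z}^{q-1}$ (the semi-cross). Suppose every tiling of $\mathbb{Z}^{q-1}$ by translates of $V_{q-1}$ is a lattice tiling. Then for every $n$ and every $V=\{\mathbf{0},\mathbf{v}_1,\dots,\mathbf{v}_{q-1}\}\subset\mathbb{Z}^n$ of size $q$ such that $\mathbf{v}_1,\dots,\mathbf{v}_{q-1}$ generate $\mathbb{Z}^n$, every tiling of $\mathbb{Z}^n$ by translates of $V$ is a lattice tiling.
   Context: $\mathbf{e}_i$ denotes the $i$-th standard basis vector. A tiling of $\mathbb{Z}^n$ by translates of $V$ is a family $\{V+l: l\in\mathcal{L}\}$, $\mathcal{L}\subset\mathbb{Z}^n$, such that every $x\in\mathbb{Z}^n$ can be written uniquely as $x=v+l$ with $v\in V$, $l\in\mathcal{L}$; it is a lattice tiling if $\mathcal{L}$ is a subgroup of $\mathbb{Z}^n$.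
   Formalization: "Every tiling is a lattice tiling" is read up to translation: some translate of the translation set is a subgroup, in both hypothesis and conclusion; read literally it fails for every semi-cross, since translating a tiling moves 0 out of the set. *)

theory Defs
  imports
    "Jordan_Normal_Form.Matrix"
    "HOL-Algebra.Generated_Groups"
    "HOL-Computational_Algebra.Primes"
begin

abbreviation Zn :: "nat \<Rightarrow> int vec monoid" where
  "Zn n \<equiv> monoid_vec TYPE(int) n"

lemma comm_group_Zn: "comm_group (Zn n)"
proof -
  interpret comm_monoid "Zn n" by (rule comm_monoid_vec)
  show ?thesis
  proof (rule group.group_comm_groupI)
    show "group (Zn n)"
    proof (rule groupI)
      fix x assume "x \<in> carrier (Zn n)"
      then show "\<exists>y\<in>carrier (Zn n). y \<otimes>\<^bsub>Zn n\<^esub> x = \<one>\<^bsub>Zn n\<^esub>"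
        by (intro bexI[of _ "- x"]) (auto simp: monoid_vec_simps)
    qed (auto simp: m_assoc)
  qed (rule m_comm)
qed

text \<open>The coordinates of \<^typ>\<open>int vec\<close> are numbered from 0, so the standard basis of
  \<open>\<int>\<^sup>n\<close> is \<open>unit_vec n 0, \<dots>, unit_vec n (n - 1)\<close>.\<close>

definition semi_cross :: "nat \<Rightarrow> int vec set" where
  "semi_cross n = insert (0\<^sub>v n) (unit_vec n ` {..<n})"

definition is_tiling :: "nat \<Rightarrow> int vec set \<Rightarrow> int vec set \<Rightarrow> bool" where
  "is_tiling n V L \<longleftrightarrow>
     V \<subseteq> carrier_vec n \<and> L \<subseteq> carrier_vec n \<and>
     (\<forall>x\<in>carrier_vec n. \<exists>!p. p \<in> V \<times> L \<and> x = fst p + snd p)"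

definition is_lattice_tiling :: "nat \<Rightarrow> int vec set \<Rightarrow> int vec set \<Rightarrow> bool" where
  "is_lattice_tiling n V L \<longleftrightarrow> is_tiling n V L \<and> subgroup L (Zn n)"

text \<open>Any translate of a tiling is a tiling (\<open>is_tiling_translate\<close> below), and at most those
  translates whose translation set contains 0 can have a subgroup as translation set. The claim
  that every tiling by \<open>V\<close> is a lattice tiling is therefore understood up to a translation of
  the whole tiling; read without it, it would fail for each \<open>V\<close> with at least two elements
  that tiles at all.\<close>

definition every_tiling_lattice :: "nat \<Rightarrow> int vec set \<Rightarrow> bool" where
  "every_tiling_lattice n V \<longleftrightarrow>
     (\<forall>L. is_tiling n V L \<longrightarrow>
        (\<exists>t\<in>carrier_vec n. is_lattice_tiling n V ((\<lambda>l. l + t) ` L)))"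

lemma is_tiling_translate:
  assumes L: "is_tiling n V L" and t: "t \<in> carrier_vec n"
  shows "is_tiling n V ((\<lambda>l. l + t) ` L)"
proof -
  have V: "V \<subseteq> carrier_vec n" and LC: "L \<subseteq> carrier_vec n"
    using L by (auto simp: is_tiling_def)
  have "\<exists>!p. p \<in> V \<times> ((\<lambda>l. l + t) ` L) \<and> x = fst p + snd p" if x: "x \<in> carrier_vec n" for x
  proof -
    have eq: "x - t = v + l \<longleftrightarrow> x = v + (l + t)" if "v \<in> V" "l \<in> L" for v l
    proof -
      have "v \<in> carrier_vec n" "l \<in> carrier_vec n" using that V LC by auto
      then show ?thesis using x t by (simp add: vec_eq_iff eq_diff_eq diff_eq_eq add.assoc)
    qed
    have "x - t \<in> carrier_vec n" using x t by auto
    then have ex1: "\<exists>!p. p \<in> V \<times> L \<and> x - t = fst p + snd p"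
      using L by (auto simp: is_tiling_def)
    then obtain p where p: "p \<in> V \<times> L" "x - t = fst p + snd p" by blast
    obtain v l where vl: "v \<in> V" "l \<in> L" "x - t = v + l"
      using p by (cases p) (metis SigmaE2 fst_conv snd_conv)
    show ?thesis
    proof (rule ex1I[of _ "(v, l + t)"])
      show "(v, l + t) \<in> V \<times> ((\<lambda>l. l + t) ` L) \<and> x = fst (v, l + t) + snd (v, l + t)"
        using vl eq by simp
    next
      fix p assume p: "p \<in> V \<times> ((\<lambda>l. l + t) ` L) \<and> x = fst p + snd p"
      then obtain v' l' where p': "p = (v', l' + t)" "v' \<in> V" "l' \<in> L" "x = v' + (l' + t)"
        by auto
      then have "x - t = v' + l'" using eq by simp
      with ex1 vl p' have "(v', l') = (v, l)" by (metis SigmaI fst_conv snd_conv)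
      with p' show "p = (v, l + t)" by simp
    qed
  qed
  moreover have "(\<lambda>l. l + t) ` L \<subseteq> carrier_vec n" using LC t by auto
  ultimately show ?thesis using V by (auto simp: is_tiling_def)
qed

end

theory Submission
  imports Defs
begin

text \<open>A surjective homomorphism \<open>f\<close> that is injective on \<open>W\<close> pulls a tiling by \<open>f ` W\<close> with
  translation set \<open>L\<close> back to a tiling by \<open>W\<close> with translation set \<open>f\<^sup>-\<^sup>1(L)\<close>. If a translate of
  \<open>f\<^sup>-\<^sup>1(L)\<close> is a subgroup, its image is a subgroup and a translate of \<open>L\<close>. The theorem is the
  case of the homomorphism \<open>\<int>\<^sup>q\<^sup>-\<^sup>1 \<rightarrow> \<int>\<^sup>n\<close> sending the \<open>i\<close>-th standard basis vector to the
  \<open>i\<close>-th generator.\<close>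

text \<open>A decomposition of \<open>f x\<close> as \<open>f w + l\<close> determines
  \<open>w\<close>, because \<open>f\<close> is injective on \<open>W\<close>. The other summand of
  \<open>x\<close> can then only be \<open>x - w\<close>, and cancelling \<open>f w\<close> shows
  that \<open>f\<close> sends it to \<open>l\<close>.\<close>

lemma is_tiling_preimage:
  assumes f: "f \<in> hom (Zn m) (Zn n)"
    and W: "W \<subseteq> carrier_vec m" and inj: "inj_on f W"
    and L: "is_tiling n (f ` W) L"
  shows "is_tiling m W {x \<in> carrier_vec m. f x \<in> L}"
proof -
  have fc: "f x \<in> carrier_vec n" if "x \<in> carrier_vec m" for x
    using f that by (auto simp: hom_def monoid_vec_simps)
  have fadd: "f (x + y) = f x + f y" if "x \<in> carrier_vec m" "y \<in> carrier_vec m" for x y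
    using f that by (auto simp: hom_def monoid_vec_simps)
  have LC: "L \<subseteq> carrier_vec n"
    using L by (auto simp: is_tiling_def)
  have "\<exists>!p. p \<in> W \<times> {x \<in> carrier_vec m. f x \<in> L} \<and> x = fst p + snd p"
    if x: "x \<in> carrier_vec m" for x
  proof -
    have ex1: "\<exists>!p. p \<in> f ` W \<times> L \<and> f x = fst p + snd p"
      using L fc[OF x] by (auto simp: is_tiling_def)
    then obtain p where "p \<in> f ` W \<times> L" "f x = fst p + snd p"
      by blast
    then obtain w l where wl: "w \<in> W" "l \<in> L" "f x = f w + l"
      by auto
    have w: "w \<in> carrier_vec m" and l: "l \<in> carrier_vec n"
      using wl W LC by auto
    have xw: "x = w + (x - w)" "x - w \<in> carrier_vec m"
      using x w by auto
    have "f x = f w + f (x - w)"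
      using fadd[OF w xw(2)] xw(1) by simp
    with wl(3) have "f w + f (x - w) = f w + l"
      by simp
    then have "f (x - w) = l"
      using fc[OF w] fc[OF xw(2)] l by (simp add: vec_eq_iff)
    show ?thesis
    proof (rule ex1I[of _ "(w, x - w)"])
      show "(w, x - w) \<in> W \<times> {x \<in> carrier_vec m. f x \<in> L} \<and> x = fst (w, x - w) + snd (w, x - w)"
        using wl xw \<open>f (x - w) = l\<close> by simp
    next
      fix p assume "p \<in> W \<times> {x \<in> carrier_vec m. f x \<in> L} \<and> x = fst p + snd p"
      then obtain w' y where p: "p = (w', y)" "w' \<in> W" "y \<in> carrier_vec m" "f y \<in> L" "x = w' + y"
        by auto
      have w': "w' \<in> carrier_vec m"
        using p W by auto
      have "f x = f w' + f y"
        using fadd[OF w' p(3)] p(5) by simp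
      \<comment> \<open>Any decomposition of \<open>x\<close> maps to one of \<open>f x\<close>, so
        uniqueness in the given tiling applies to the images; injectivity brings it back to
        \<open>W\<close>.\<close>
      with ex1 wl p have "(f w', f y) = (f w, l)"
        by (metis SigmaI fst_conv imageI snd_conv)
      then have "w' = w"
        using inj p wl by (auto dest: inj_onD)
      moreover have "y = x - w'"
        using p w' by (auto simp: vec_eq_iff)
      ultimately show "p = (w, x - w)"
        using p by simp
    qed
  qed
  with W show ?thesis
    by (auto simp: is_tiling_def)
qed

lemma every_tiling_lattice_image:
  assumes f: "f \<in> hom (Zn m) (Zn n)" and surj: "f ` carrier_vec m = carrier_vec n"
    and W: "W \<subseteq> carrier_vec m" and inj: "inj_on f W"
    and lattice: "every_tiling_lattice m W"
  shows "every_tiling_lattice n (f ` W)"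
  unfolding every_tiling_lattice_def
proof (intro allI impI)
  fix L assume L: "is_tiling n (f ` W) L"
  define K where "K = {x \<in> carrier_vec m. f x \<in> L}"
  have fadd: "f (x + y) = f x + f y" if "x \<in> carrier_vec m" "y \<in> carrier_vec m" for x y
    using f that by (auto simp: hom_def monoid_vec_simps)
  interpret group_hom "Zn m" "Zn n" f
    using f comm_group_Zn
    by (simp add: group_hom_def group_hom_axioms_def comm_group.axioms(2))
  have "is_tiling m W K"
    unfolding K_def by (rule is_tiling_preimage[OF f W inj L])
  then obtain t where t: "t \<in> carrier_vec m" and sub: "subgroup ((\<lambda>l. l + t) ` K) (Zn m)"
    using lattice by (auto simp: every_tiling_lattice_def is_lattice_tiling_def)
  \<comment> \<open>Surjectivity enters here: each element of \<open>L\<close> needs a preimage,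
    which then lies in \<open>K\<close>.\<close>
  have "L \<subseteq> f ` carrier_vec m"
    using L surj by (auto simp: is_tiling_def)
  then have "f ` K = L"
    by (auto simp: K_def)
  \<comment> \<open>A homomorphism turns translation of \<open>K\<close> by \<open>t\<close> into
    translation of \<open>L\<close> by \<open>f t\<close>, so \<open>f t\<close> is the
    witness.\<close>
  have "f ` (\<lambda>l. l + t) ` K = (\<lambda>x. f x + f t) ` K"
    unfolding image_image using t by (intro image_cong) (auto simp: K_def fadd)
  also have "\<dots> = (\<lambda>l. l + f t) ` L"
    unfolding \<open>f ` K = L\<close>[symmetric] image_image by simp
  finally have "subgroup ((\<lambda>l. l + f t) ` L) (Zn n)"
    using subgroup_img_is_subgroup[OF sub] by simp
  moreover have ft: "f t \<in> carrier_vec n"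
    using t surj by auto
  ultimately show "\<exists>t\<in>carrier_vec n. is_lattice_tiling n (f ` W) ((\<lambda>l. l + t) ` L)"
    using is_tiling_translate[OF L ft] by (auto simp: is_lattice_tiling_def)
qed

text \<open>The group is free on the unit vectors: use the coordinates of \<open>x\<close> as
  coefficients of the \<open>u i\<close>. Summing entry by entry fixes the dimension
  \<open>n\<close> of the result even for \<open>m = 0\<close>.\<close>

lemma hom_Zn_unit_vec_exists:
  assumes "\<And>i. i < m \<Longrightarrow> u i \<in> carrier_vec n"
  obtains f where "f \<in> hom (Zn m) (Zn n)" "\<And>i. i < m \<Longrightarrow> f (unit_vec m i) = u i"
proof
  let ?f = "\<lambda>x. vec n (\<lambda>j. \<Sum>i<m. x $ i * u i $ j)"
  show "?f \<in> hom (Zn m) (Zn n)"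
    by (auto simp: hom_def monoid_vec_simps vec_eq_iff sum.distrib[symmetric] distrib_right)
  show "?f (unit_vec m i) = u i" if "i < m" for i
  proof (rule eq_vecI)
    fix j assume "j < dim_vec (u i)"
    then have "j < n"
      using assms[OF that] by simp
    have "(\<Sum>k<m. unit_vec m i $ k * u k $ j) = (\<Sum>k<m. if k = i then u k $ j else 0)"
      using that by (intro sum.cong) auto
    with that \<open>j < n\<close> show "?f (unit_vec m i) $ j = u i $ j"
      by simp
  qed (use assms[OF that] in simp)
qed

theorem theorem21:
  fixes q :: nat
  assumes "prime q"
    and "every_tiling_lattice (q - 1) (semi_cross (q - 1))"
  shows "\<forall>(n :: nat) (v :: nat \<Rightarrow> int vec) V.
           v ` {1..q - 1} \<subseteq> carrier_vec n \<longrightarrow>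
           V = insert (0\<^sub>v n) (v ` {1..q - 1}) \<longrightarrow>
           card V = q \<longrightarrow>
           generate (Zn n) (v ` {1..q - 1}) = carrier_vec n \<longrightarrow>
           every_tiling_lattice n V"
proof (intro allI impI)
  fix n :: nat and v :: "nat \<Rightarrow> int vec" and V
  assume v: "v ` {1..q - 1} \<subseteq> carrier_vec n"
    and V: "V = insert (0\<^sub>v n) (v ` {1..q - 1})"
    and card: "card V = q"
    and gen: "generate (Zn n) (v ` {1..q - 1}) = carrier_vec n"
  define m where "m = q - 1"
  have q: "q = Suc m"
    using prime_gt_0_nat[OF assms(1)] by (simp add: m_def)
  \<comment> \<open>Coordinates are numbered from 0 and generators from 1, hence the shift by
    \<open>Suc\<close>.\<close>
  have "v (Suc i) \<in> carrier_vec n" if "i < m" for i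
    using v that by (auto simp: q)
  then obtain f where f: "f \<in> hom (Zn m) (Zn n)"
    and f_unit: "\<And>i. i < m \<Longrightarrow> f (unit_vec m i) = v (Suc i)"
    using hom_Zn_unit_vec_exists[of m "\<lambda>i. v (Suc i)" n] by blast
  interpret group_hom "Zn m" "Zn n" f
    using f comm_group_Zn
    by (simp add: group_hom_def group_hom_axioms_def comm_group.axioms(2))
  have units: "unit_vec m ` {..<m} \<subseteq> carrier (Zn m)"
    by (auto simp: monoid_vec_simps)
  have f_units: "f ` unit_vec m ` {..<m} = v ` {1..q - 1}"
  proof -
    have "f ` unit_vec m ` {..<m} = v ` Suc ` {..<m}"
      unfolding image_image using f_unit by (intro image_cong) auto
    then show ?thesis
      by (simp add: q image_Suc_lessThan)
  qed
  have "f (0\<^sub>v m) = 0\<^sub>v n"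
    using hom_one by (simp add: monoid_vec_simps)
  then have fW: "f ` semi_cross m = V"
    unfolding semi_cross_def V image_insert f_units by simp
  have W: "semi_cross m \<subseteq> carrier_vec m"
    by (auto simp: semi_cross_def)
  have "finite (semi_cross m)"
    by (simp add: semi_cross_def)
  \<comment> \<open>Injectivity by counting: the semi-cross has at most \<open>Suc m\<close>
    elements and its image \<open>V\<close> has exactly that many, so no two can be
    identified.\<close>
  moreover have "card (f ` semi_cross m) = card (semi_cross m)"
  proof (rule antisym)
    show "card (f ` semi_cross m) \<le> card (semi_cross m)"
      using \<open>finite (semi_cross m)\<close> by (rule card_image_le)
    have "card (semi_cross m) \<le> Suc (card (unit_vec m ` {..<m} :: int vec set))"
      unfolding semi_cross_def by (rule card_insert_le_m1) auto
    also have "\<dots> \<le> Suc m"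
      using card_image_le[of "{..<m}" "unit_vec m :: nat \<Rightarrow> int vec"] by simp
    finally show "card (semi_cross m) \<le> card (f ` semi_cross m)"
      using card by (simp add: fW q)
  qed
  ultimately have inj: "inj_on f (semi_cross m)"
    by (rule eq_card_imp_inj_on)
  \<comment> \<open>The image of a generated subgroup is generated by the images, so the span of the
    unit vectors already maps onto the target; surjectivity follows by inclusion.\<close>
  have "carrier_vec n = f ` generate (Zn m) (unit_vec m ` {..<m})"
    using generate_img[OF units] gen f_units by simp
  moreover have "generate (Zn m) (unit_vec m ` {..<m}) \<subseteq> carrier_vec m"
    using G.generate_incl[OF units] by (simp add: monoid_vec_simps)
  moreover have "f ` carrier_vec m \<subseteq> carrier_vec n"
    using f by (auto simp: hom_def monoid_vec_simps)
  ultimately have "f ` carrier_vec m = carrier_vec n"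
    by blast
  from every_tiling_lattice_image[OF f this W inj] assms(2)[folded m_def]
  show "every_tiling_lattice n V"
    by (simp add: fW)
qed

end
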